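(* For almost all trees $T\in\mathcal{T}_n$, $$a_t(T)\ge \frac{n}{3e^3}.$$
   Context: $\mathcal{T}_n$ is the family of labelled trees on $n$ vertices. A property holds for almost all trees if the ratio of the number of trees in $\mathcal{T}_n$ with the property to $|\mathcal{T}_n|$ tends to $1$ as $n\to\infty$. Total acquisition number: in a graph $G$, every vertex initially has weight $1$. A total acquisition move transfers all the weight from a vertex $v$ onto an adjacent vertex $u$, allowed only if immediately before the move the weight on $u$ is at least the weight on $v$. A maximal sequence of such moves is an acquisition protocol, and the set of vertices with positive weight at its end is a residual set. $a_t(G)$ is the minimum possible size of a residual set. *)

theory Defs
  imports Complex_Main "Graph_Theory.Graph_Theory"
begin

text \<open>
  Graphs are symmetric loop-free digraphs (\<^locale>\<open>pair_graph\<close>). The predicate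
  \<^const>\<open>Digraph_Component.tree\<close> is not usable for them: it takes directed cycles, so
  an edge traversed back and forth already counts as a cycle. A cycle of an undirected
  graph is one with at least three arcs.
\<close>

definition undirected_tree :: "'a pair_pre_digraph \<Rightarrow> bool" where
  "undirected_tree G \<longleftrightarrow>
     pair_graph G \<and> Digraph_Component.connected (with_proj G) \<and>
     \<not> (\<exists>p. pre_digraph.cycle (with_proj G) p \<and> length p \<ge> 3)"

definition labelled_trees :: "nat \<Rightarrow> nat pair_pre_digraph set" where
  "labelled_trees n = {T. pverts T = {1..n} \<and> undirected_tree T}"

definition almost_all_trees :: "(nat \<Rightarrow> nat pair_pre_digraph \<Rightarrow> bool) \<Rightarrow> bool" where
  "almost_all_trees P \<longleftrightarrow>
     (\<lambda>n. real (card {T \<in> labelled_trees n. P n T}) / real (card (labelled_trees n)))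
       \<longlonglongrightarrow> 1"

text \<open>
  The move \<open>(v, u)\<close> transfers all the weight of \<open>v\<close> to \<open>u\<close>. There must be some weight to
  transfer: with void moves allowed, no sequence of moves would be maximal.
\<close>

definition acquisition_move ::
    "'a pair_pre_digraph \<Rightarrow> ('a \<Rightarrow> nat) \<Rightarrow> 'a \<times> 'a \<Rightarrow> bool" where
  "acquisition_move G w = (\<lambda>(v, u). (v, u) \<in> parcs G \<and> 0 < w v \<and> w v \<le> w u)"

definition transfer_weight :: "('a \<Rightarrow> nat) \<Rightarrow> 'a \<times> 'a \<Rightarrow> 'a \<Rightarrow> nat" where
  "transfer_weight w = (\<lambda>(v, u). w(u := w u + w v, v := 0))"

primrec acquisition_moves ::
    "'a pair_pre_digraph \<Rightarrow> ('a \<Rightarrow> nat) \<Rightarrow> ('a \<times> 'a) list \<Rightarrow> bool" where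
  "acquisition_moves G w [] \<longleftrightarrow> True"
| "acquisition_moves G w (m # ms) \<longleftrightarrow>
     acquisition_move G w m \<and> acquisition_moves G (transfer_weight w m) ms"

definition acquisition_protocol :: "'a pair_pre_digraph \<Rightarrow> ('a \<times> 'a) list \<Rightarrow> bool" where
  "acquisition_protocol G ms \<longleftrightarrow>
     acquisition_moves G (\<lambda>_. 1) ms \<and>
     \<not> (\<exists>ms'. ms' \<noteq> [] \<and> acquisition_moves G (\<lambda>_. 1) (ms @ ms'))"

definition residual_set :: "'a pair_pre_digraph \<Rightarrow> 'a set \<Rightarrow> bool" where
  "residual_set G S \<longleftrightarrow>
     (\<exists>ms. acquisition_protocol G ms \<and>
           S = {v \<in> pverts G. foldl transfer_weight (\<lambda>_. 1) ms v > 0})"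

definition total_acquisition_number :: "'a pair_pre_digraph \<Rightarrow> nat" where
  "total_acquisition_number G = (LEAST k. \<exists>S. residual_set G S \<and> card S = k)"

text \<open>
  Every move empties a vertex for good, so protocols exist on a finite graph and the minimum
  is taken over a nonempty set.
\<close>

lemma acquisition_moves_length:
  assumes "pair_graph G" "acquisition_moves G w ms"
  shows "length ms \<le> card {v \<in> pverts G. w v > 0}"
  using assms(2)
proof (induction ms arbitrary: w)
  case (Cons m ms)
  interpret pair_graph G by fact
  obtain v u where m: "m = (v, u)" by fastforce
  have vu: "(v, u) \<in> parcs G" "0 < w v" "w v \<le> w u"
    using Cons.prems by (auto simp: m acquisition_move_def)
  have "v \<in> pverts G" "v \<noteq> u"
    using vu(1) in_arcsD1 pair_no_loops by fastforce+
  have "{x \<in> pverts G. transfer_weight w m x > 0} \<subset> {x \<in> pverts G. w x > 0}"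
    using vu \<open>v \<in> pverts G\<close> \<open>v \<noteq> u\<close> by (auto simp: m transfer_weight_def)
  then have "card {x \<in> pverts G. transfer_weight w m x > 0} < card {x \<in> pverts G. w x > 0}"
    by (intro psubset_card_mono) (simp_all add: pair_finite_verts)
  moreover have "length ms \<le> card {x \<in> pverts G. transfer_weight w m x > 0}"
    using Cons by simp
  ultimately show ?case by simp
qed simp

lemma residual_set_exists:
  assumes "pair_graph G"
  shows "\<exists>S. residual_set G S"
proof -
  let ?P = "acquisition_moves G (\<lambda>_. 1)"
  have bound: "\<forall>ms. ?P ms \<longrightarrow> length ms < Suc (card (pverts G))"
    using acquisition_moves_length[OF assms, of "\<lambda>_. 1"] by (auto simp: less_Suc_eq_le)
  have "?P []" by simp
  then obtain ms where ms: "?P ms" "\<forall>ms'. ?P ms' \<longrightarrow> length ms' \<le> length ms"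
    using ex_has_greatest_nat[of ?P "[]" length "Suc (card (pverts G))"] bound
    by (metis less_imp_le_nat)
  then have "acquisition_protocol G ms"
    unfolding acquisition_protocol_def by (metis add_le_same_cancel1 le_zero_eq length_0_conv
      length_append add.commute)
  then show ?thesis unfolding residual_set_def by blast
qed

end

theory Submission
  imports Defs
begin

text \<open>
  Call \<open>(a, b, c)\<close> a pendant path if \<open>a\<close> is a leaf with neighbour \<open>b\<close>, the vertex \<open>b\<close> has
  neighbours \<open>a\<close> and \<open>c\<close>, and \<open>c\<close> has one further neighbour \<open>d\<close>. No protocol clears a pendant
  path: to move on, the weight of \<open>a\<close> must go to \<open>b\<close> and then to \<open>c\<close>, so \<open>c\<close> needs weight at least
  2 beforehand, which it can only get from \<open>d\<close>; but then \<open>d\<close> is empty and \<open>c\<close> is stuck. Distinct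
  pendant paths are disjoint, hence \<open>a\<^sub>t(T)\<close> is at least the number \<open>X(T)\<close> of pendant paths.
  Deleting a pendant path leaves a tree on \<open>n - 3\<close> vertices together with the vertex \<open>d\<close>, so with
  Cayley's formula the mean of \<open>X\<close> over all trees is \<open>\<mu>(n) \<sim> n / e\<^sup>3\<close>. Reinserting a pendant path
  increases \<open>X\<close> by at most one, so its second moment is at most \<open>\<mu>(n) (1 + \<mu>(n - 3))\<close>, and
  Chebyshev's inequality gives \<open>X \<ge> n / (3 e\<^sup>3)\<close> for almost all trees.
\<close>

section \<open>Trees as arc sets\<close>

text \<open>A cycle is given by its vertices; the modulus supplies the closing arc from the last
  vertex back to the first.\<close>

definition cyclic_list :: "'a rel \<Rightarrow> 'a list \<Rightarrow> bool" where
  "cyclic_list E vs \<longleftrightarrow> distinct vs \<and>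
     (\<forall>i<length vs. (vs ! i, vs ! (Suc i mod length vs)) \<in> E)"

text \<open>Connectivity is phrased through closed sets, which allows arguments without walks. The
  bound is \<open>< 3\<close> because with symmetric arcs every edge yields a cyclic list of length
  2.\<close>

definition tree_on :: "'a set \<Rightarrow> 'a rel \<Rightarrow> bool" where
  "tree_on V E \<longleftrightarrow> finite V \<and> V \<noteq> {} \<and> E \<subseteq> V \<times> V \<and> sym E \<and> irrefl E \<and>
     (\<forall>C\<subseteq>V. C \<noteq> {} \<longrightarrow> E `` C \<subseteq> C \<longrightarrow> C = V) \<and>
     (\<forall>vs. cyclic_list E vs \<longrightarrow> length vs < 3)"

section \<open>From arc walks and reachability to vertex lists and closed sets\<close>

lemma pcas_conv_nth:
  "p \<noteq> [] \<Longrightarrow> pcas u p v \<longleftrightarrow>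
     fst (hd p) = u \<and> snd (last p) = v \<and>
     (\<forall>i<length p - 1. snd (p ! i) = fst (p ! Suc i))"
proof (induction p arbitrary: u)
  case (Cons e p)
  show ?case
  proof (cases p)
    case (Cons f q)
    have "(\<forall>i<length (e # p) - 1. snd ((e # p) ! i) = fst ((e # p) ! Suc i)) \<longleftrightarrow>
        snd e = fst f \<and> (\<forall>i<length p - 1. snd (p ! i) = fst (p ! Suc i))"
      by (simp add: Cons All_less_Suc2)
    then show ?thesis
      using Cons.IH by (auto simp: Cons)
  qed auto
qed auto

lemma pawalk_verts_conv_map:
  "pcas u p v \<Longrightarrow> pawalk_verts u p = u # map snd p"
  by (induction p arbitrary: u) auto

lemma cycle_with_proj_iff:
  assumes "parcs G \<subseteq> pverts G \<times> pverts G"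
  shows "pre_digraph.cycle (with_proj G) p \<longleftrightarrow>
    p \<noteq> [] \<and> set p \<subseteq> parcs G \<and> distinct (map snd p) \<and>
    (\<forall>i<length p. snd (p ! i) = fst (p ! (Suc i mod length p)))"
proof (cases "p = []")
  case False
  \<comment> \<open>The last index wraps around to 0; split off from the others, it says that the
    walk is closed.\<close>
  have [simp]: "(\<forall>i<length p. snd (p ! i) = fst (p ! (Suc i mod length p))) \<longleftrightarrow>
      pcas (fst (hd p)) p (fst (hd p))"
  proof -
    obtain k where k: "length p = Suc k" using False by (cases p) auto
    then show ?thesis
      using False by (auto simp: pcas_conv_nth All_less_Suc hd_conv_nth last_conv_nth)
  qed
  have "pre_digraph.cycle (with_proj G) p \<longleftrightarrow>
     (\<exists>u. u \<in> pverts G \<and> set p \<subseteq> parcs G \<and> pcas u p u \<and> distinct (tl (pawalk_verts u p)))"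
    using False
    by (simp add: pre_digraph.cycle_def pre_digraph.awalk_def cas_with_proj_eq
        awalk_verts_with_proj_eq)
  also have "\<dots> \<longleftrightarrow> set p \<subseteq> parcs G \<and> pcas (fst (hd p)) p (fst (hd p)) \<and> distinct (map snd p)"
    using False assms
    by (cases p) (force simp: pawalk_verts_conv_map)+
  finally show ?thesis using False by auto
qed (simp add: pre_digraph.cycle_def)

text \<open>A cycle of arcs is turned into the list of its arc heads, and a vertex list into the
  arcs between cyclically consecutive vertices.\<close>

lemma cycle_length_iff_cyclic_list:
  assumes "parcs G \<subseteq> pverts G \<times> pverts G" "k > 0"
  shows "(\<exists>p. pre_digraph.cycle (with_proj G) p \<and> length p = k) \<longleftrightarrow>
    (\<exists>vs. cyclic_list (parcs G) vs \<and> length vs = k)"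
proof
  assume "\<exists>p. pre_digraph.cycle (with_proj G) p \<and> length p = k"
  then obtain p where p: "pre_digraph.cycle (with_proj G) p" "length p = k" by auto
  have "(map snd p ! i, map snd p ! (Suc i mod k)) \<in> parcs G" if "i < k" for i
  proof -
    have "Suc i mod k < k" using assms by simp
    moreover from this have "p ! (Suc i mod k) \<in> parcs G"
      using p assms by (auto simp: cycle_with_proj_iff)
    moreover have "snd (p ! i) = fst (p ! (Suc i mod k))"
      using p that assms by (auto simp: cycle_with_proj_iff)
    ultimately show ?thesis using that p by simp
  qed
  then have "cyclic_list (parcs G) (map snd p)"
    using p assms by (auto simp: cycle_with_proj_iff cyclic_list_def)
  then show "\<exists>vs. cyclic_list (parcs G) vs \<and> length vs = k"
    using p by (metis length_map)
next
  assume "\<exists>vs. cyclic_list (parcs G) vs \<and> length vs = k"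
  then obtain vs where vs: "cyclic_list (parcs G) vs" "length vs = k" by auto
  define p where "p = map (\<lambda>i. (vs ! i, vs ! (Suc i mod k))) [0..<k]"
  \<comment> \<open>The heads of these arcs are \<open>vs\<close> shifted by one place, so they
    inherit distinctness.\<close>
  have "map snd p = rotate1 vs"
    by (rule nth_equalityI) (auto simp: p_def vs nth_rotate1)
  then have "distinct (map snd p)"
    using vs by (simp add: cyclic_list_def)
  then have "pre_digraph.cycle (with_proj G) p"
    using vs assms
    by (auto simp: cycle_with_proj_iff cyclic_list_def p_def)
  then show "\<exists>p. pre_digraph.cycle (with_proj G) p \<and> length p = k"
    by (auto simp: p_def)
qed

text \<open>The set reachable from a vertex is closed under arcs; conversely a closed set contains
  everything reachable from its members.\<close>

lemma strongly_connected_sym_iff: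
  assumes "sym (parcs G)" "parcs G \<subseteq> pverts G \<times> pverts G"
  shows "strongly_connected (with_proj G) \<longleftrightarrow> pverts G \<noteq> {} \<and>
    (\<forall>C\<subseteq>pverts G. C \<noteq> {} \<longrightarrow> parcs G `` C \<subseteq> C \<longrightarrow> C = pverts G)"
    (is "_ \<longleftrightarrow> _ \<and> ?R")
proof -
  let ?r = "\<lambda>u v. (u, v) \<in> rtrancl_on (pverts G) (parcs G)"
  have "(\<forall>u\<in>pverts G. \<forall>v\<in>pverts G. ?r u v) \<longleftrightarrow> ?R"
  proof (intro iffI allI impI ballI)
    fix C assume r: "\<forall>u\<in>pverts G. \<forall>v\<in>pverts G. ?r u v"
      and C: "C \<subseteq> pverts G" "C \<noteq> {}" "parcs G `` C \<subseteq> C"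
    obtain u where u: "u \<in> C" using C by auto
    have "v \<in> C" if "?r u v" for v
      using that by (induction rule: rtrancl_on_induct) (use u C in auto)
    then show "C = pverts G" using r u C by auto
  next
    fix u v assume R: ?R and uv: "u \<in> pverts G" "v \<in> pverts G"
    have "{v. ?r u v} \<subseteq> pverts G" by (auto dest: in_rtrancl_on_in_F)
    moreover have "?r u u" using uv by auto
    moreover have "parcs G `` {v. ?r u v} \<subseteq> {v. ?r u v}"
      using assms(2) by (auto intro: rtrancl_on_into_rtrancl_on)
    ultimately have "{v. ?r u v} = pverts G" using R by blast
    then show "?r u v" using uv by auto
  qed
  then show ?thesis by (simp add: strongly_connected_def reachable_def)
qed

lemma pair_graph_iff:
  "pair_graph G \<longleftrightarrow> finite (pverts G) \<and> parcs G \<subseteq> pverts G \<times> pverts G \<and> sym (parcs G) \<and>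
     irrefl (parcs G)"
proof
  assume "pair_graph G"
  then interpret pair_graph G .
  show "finite (pverts G) \<and> parcs G \<subseteq> pverts G \<times> pverts G \<and> sym (parcs G) \<and> irrefl (parcs G)"
    using pair_finite_verts wellformed' arcs_symmetric pair_no_loops
    by (fastforce simp: sym_def irrefl_def)
next
  assume *: "finite (pverts G) \<and> parcs G \<subseteq> pverts G \<times> pverts G \<and> sym (parcs G) \<and>
    irrefl (parcs G)"
  then have "finite (parcs G)" by (meson finite_SigmaI finite_subset)
  moreover have "fst e \<in> pverts G \<and> snd e \<in> pverts G \<and> fst e \<noteq> snd e" if "e \<in> parcs G" for e
    using that * by (cases e) (auto simp: irrefl_def)
  ultimately show "pair_graph G"
    using * by unfold_locales (simp_all add: symmetric_def)
qed

lemma undirected_tree_iff: "undirected_tree G \<longleftrightarrow> tree_on (pverts G) (parcs G)"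
proof (cases "pair_graph G")
  case True
  then have G: "finite (pverts G)" "parcs G \<subseteq> pverts G \<times> pverts G" "sym (parcs G)"
    "irrefl (parcs G)" by (auto simp: pair_graph_iff)
  have "mk_symmetric (with_proj G) = G"
    using G(3) by (cases G) (auto simp: mk_symmetric_def sym_def)
  then have conn: "Digraph_Component.connected (with_proj G) = strongly_connected (with_proj G)"
    by (simp add: Digraph_Component.connected_def)
  have "(\<exists>p. pre_digraph.cycle (with_proj G) p \<and> length p \<ge> 3) \<longleftrightarrow>
      (\<exists>k\<ge>3. \<exists>p. pre_digraph.cycle (with_proj G) p \<and> length p = k)" by blast
  also have "\<dots> \<longleftrightarrow> (\<exists>k\<ge>3. \<exists>vs. cyclic_list (parcs G) vs \<and> length vs = k)"
    by (intro ex_cong1 conj_cong refl cycle_length_iff_cyclic_list[OF G(2)]) simp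
  also have "\<dots> \<longleftrightarrow> \<not> (\<forall>vs. cyclic_list (parcs G) vs \<longrightarrow> length vs < 3)"
    by (auto simp: not_less)
  finally show ?thesis
    by (simp only: undirected_tree_def tree_on_def conn strongly_connected_sym_iff[OF G(3,2)]
        True G simp_thms conj_assoc)
qed (simp only: undirected_tree_def tree_on_def pair_graph_iff, blast)

lemma tree_onD:
  assumes "tree_on V E"
  shows "finite V" "V \<noteq> {}" "E \<subseteq> V \<times> V" "sym E" "irrefl E"
    "\<And>C. C \<subseteq> V \<Longrightarrow> C \<noteq> {} \<Longrightarrow> E `` C \<subseteq> C \<Longrightarrow> C = V"
    "\<And>vs. cyclic_list E vs \<Longrightarrow> length vs < 3"
  using assms unfolding tree_on_def by blast+

text \<open>The successor and the predecessor of \<open>x\<close> differ once the length is at least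
  3. Hence a vertex with a single neighbour lies on no such cycle.\<close>

lemma cyclic_list_two_neighbours:
  assumes "cyclic_list E vs" "length vs \<ge> 3" "x \<in> set vs"
  obtains y z where "y \<noteq> z" "(x, y) \<in> E" "(z, x) \<in> E"
proof -
  let ?n = "length vs"
  obtain i where i: "i < ?n" "x = vs ! i" using assms by (auto simp: in_set_conv_nth)
  \<comment> \<open>\<open>j\<close> is the cyclic predecessor of \<open>i\<close>.\<close>
  define j where "j = (if i = 0 then ?n - 1 else i - 1)"
  have j: "j < ?n" "Suc j mod ?n = i" using i assms by (auto simp: j_def)
  have "Suc i mod ?n \<noteq> j"
    using i assms by (cases "Suc i = ?n") (auto simp: j_def)
  then have "vs ! (Suc i mod ?n) \<noteq> vs ! j"
    using assms j unfolding cyclic_list_def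
    by (metis gr_implies_not0 mod_less_divisor neq0_conv nth_eq_iff_index_eq)
  moreover have "(x, vs ! (Suc i mod ?n)) \<in> E" "(vs ! j, x) \<in> E"
    using assms i j unfolding cyclic_list_def by metis+
  ultimately show thesis using that by blast
qed

section \<open>Adding and removing a leaf\<close>

definition attach :: "'a \<Rightarrow> 'a \<Rightarrow> 'a rel \<Rightarrow> 'a rel" where
  "attach l p E = E \<union> {(l, p), (p, l)}"

text \<open>A cycle of length at least 3 avoids \<open>l\<close>, which has one neighbour, so it
  lies in \<open>E\<close> already. A nonempty closed set meets \<open>V\<close>, because with
  \<open>l\<close> it contains \<open>p\<close>; so it covers \<open>V\<close>, and then also
  \<open>l\<close>.\<close>

lemma tree_on_attach:
  assumes T: "tree_on V E" and "p \<in> V" "l \<notin> V"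
  shows "tree_on (insert l V) (attach l p E)"
  unfolding tree_on_def
proof (intro conjI allI impI)
  note T = tree_onD[OF T]
  show "finite (insert l V)" "insert l V \<noteq> {}" "attach l p E \<subseteq> insert l V \<times> insert l V"
    "sym (attach l p E)" "irrefl (attach l p E)"
    using T assms by (auto simp: attach_def sym_def irrefl_def)
  fix C assume C: "C \<subseteq> insert l V" "C \<noteq> {}" "attach l p E `` C \<subseteq> C"
  have "C \<inter> V \<noteq> {}" using C \<open>p \<in> V\<close> by (auto simp: attach_def)
  moreover have "E `` (C \<inter> V) \<subseteq> C \<inter> V" using C T(3) by (auto simp: attach_def)
  ultimately have "C \<inter> V = V" using T(6)[of "C \<inter> V"] by blast
  then have "p \<in> C" using \<open>p \<in> V\<close> by blast
  then have "l \<in> C" using C by (auto simp: attach_def)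
  then show "C = insert l V" using C \<open>C \<inter> V = V\<close> by auto
next
  note T = tree_onD[OF T]
  fix vs assume vs: "cyclic_list (attach l p E) vs"
  show "length vs < 3"
  proof (rule ccontr)
    assume n: "\<not> length vs < 3"
    have "l \<notin> set vs"
    proof
      assume "l \<in> set vs"
      then obtain y z where "y \<noteq> z" "(l, y) \<in> attach l p E" "(z, l) \<in> attach l p E"
        using cyclic_list_two_neighbours[OF vs] n by (metis not_less)
      then show False using T(3) assms by (auto simp: attach_def)
    qed
    then have "cyclic_list E vs"
      using vs n unfolding cyclic_list_def attach_def
      by (metis (no_types, lifting) Pair_inject UnE insertE mod_less_divisor nth_mem singletonD
          length_greater_0_conv length_pos_if_in_set)
    then show False using T(7) n by blast
  qed
qed

lemma tree_on_detach:
  assumes T: "tree_on (insert l V) E" and l: "l \<notin> V" "E `` {l} = {p}"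
  shows "p \<in> V" "tree_on V (E - {(l, p), (p, l)})"
    "attach l p (E - {(l, p), (p, l)}) = E"
proof -
  note T = tree_onD[OF T]
  have lp: "(l, x) \<in> E \<longleftrightarrow> x = p" "(x, l) \<in> E \<longleftrightarrow> x = p" for x
    using l T(4) by (auto simp: sym_def)
  then have "(l, p) \<in> E" by simp
  then show "p \<in> V" using T(3,5) by (auto simp: irrefl_def)
  let ?E = "E - {(l, p), (p, l)}"
  show "attach l p ?E = E" using lp by (auto simp: attach_def)
  have E: "?E \<subseteq> V \<times> V"
  proof
    fix e assume e: "e \<in> ?E"
    then have "fst e \<noteq> l" "snd e \<noteq> l" using lp by (cases e; auto)+
    then show "e \<in> V \<times> V" using e T(3) by (cases e) auto
  qed
  show "tree_on V ?E"
    unfolding tree_on_def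
  proof (intro conjI allI impI)
    show "finite V" "V \<noteq> {}" using T(1) \<open>p \<in> V\<close> by auto
    show "sym ?E" "irrefl ?E" using T(4,5) by (auto simp: sym_def irrefl_def)
    show "?E \<subseteq> V \<times> V" by (rule E)
    fix C assume C: "C \<subseteq> V" "C \<noteq> {}" "?E `` C \<subseteq> C"
    \<comment> \<open>If \<open>C\<close> contains \<open>p\<close>, adding \<open>l\<close> makes
      it closed under \<open>E\<close>. Without \<open>p\<close> it is closed under \<open>E\<close>
      as it stands and would have to contain \<open>l\<close>.\<close>
    show "C = V"
    proof (cases "p \<in> C")
      case True
      have "E `` insert l C \<subseteq> insert l C" using C(3) True lp by auto
      then have "insert l C = insert l V" using T(6)[of "insert l C"] C by auto
      then show ?thesis using C l by auto
    next
      case False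
      have "E `` C \<subseteq> C"
      proof
        fix y assume "y \<in> E `` C"
        then obtain x where x: "x \<in> C" "(x, y) \<in> E" by auto
        then have "x \<noteq> l" "x \<noteq> p" using C l False by auto
        then show "y \<in> C" using x C(3) by blast
      qed
      then have "C = insert l V" using T(6)[of C] C by auto
      then show ?thesis using C l by auto
    qed
  next
    fix vs assume "cyclic_list ?E vs"
    then have "cyclic_list E vs" by (auto simp: cyclic_list_def)
    then show "length vs < 3" by (rule T(7))
  qed
qed

text \<open>The unique neighbour has to exist, so a one-vertex tree has no leaf and vertices outside
  a tree are not counted.\<close>

definition leaves :: "'a rel \<Rightarrow> 'a set" where
  "leaves E = {l. \<exists>p. E `` {l} = {p}}"

lemma leaves_subset: "tree_on V E \<Longrightarrow> leaves E \<subseteq> V"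
  using tree_onD(3) by (fastforce simp: leaves_def)

text \<open>The first vertex of a longest path has no neighbour besides the second one.\<close>

lemma tree_on_has_leaf:
  assumes T: "tree_on V E" and V: "card V \<ge> 2"
  shows "leaves E \<noteq> {}"
proof -
  note T = tree_onD[OF T]
  define P where "P = (\<lambda>vs. distinct vs \<and> set vs \<subseteq> V \<and> vs \<noteq> [] \<and>
    (\<forall>i<length vs - 1. (vs ! i, vs ! Suc i) \<in> E))"
  obtain x where x: "x \<in> V" using T(2) by auto
  have "V \<noteq> {x}" using V by auto
  then obtain y where y: "(x, y) \<in> E" "y \<noteq> x" using T(6)[of "{x}"] x by auto
  have bound: "length vs < Suc (card V)" if "P vs" for vs
    using that T(1) by (metis P_def card_mono distinct_card less_Suc_eq_le)
  then obtain vs where vs: "P vs" "\<And>ws. P ws \<Longrightarrow> length ws \<le> length vs"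
  proof -
    have "P [x]" using x by (simp add: P_def)
    then show thesis
      using that ex_has_greatest_nat[of P "[x]" length "Suc (card V)"] bound
      by (meson less_imp_le)
  qed
  have "P [x, y]" using x y T(3) by (auto simp: P_def)
  then have "length vs \<ge> 2" using vs(2)[of "[x, y]"] by simp
  then obtain u w us where us: "vs = u # w # us"
    by (metis (no_types) Suc_le_length_iff numeral_2_eq_2)
  \<comment> \<open>A second neighbour \<open>z\<close> of the end \<open>u\<close> either prolongs
    the path at its front or, lying on it at an index \<open>k \<ge> 2\<close>, closes a cycle of
    length \<open>k + 1\<close>.\<close>
  have "z = w" if z: "(u, z) \<in> E" for z
  proof (rule ccontr)
    assume "z \<noteq> w"
    have sym: "(z, u) \<in> E" using T(4) z by (auto simp: sym_def)
    have "u \<noteq> z" using z T(5) by (auto simp: irrefl_def)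
    show False
    proof (cases "z \<in> set vs")
      case False
      have "((z # vs) ! i, (z # vs) ! Suc i) \<in> E" if "i < length vs" for i
        using that vs(1) sym by (cases i) (auto simp: P_def us)
      then have "P (z # vs)"
        using vs(1) False sym T(3) by (auto simp: P_def)
      then show False using vs(2)[of "z # vs"] by simp
    next
      case True
      then obtain k where k: "k < length vs" "vs ! k = z" by (auto simp: in_set_conv_nth)
      have vs01: "vs ! 0 = u" "vs ! 1 = w" by (simp_all add: us)
      then have "k \<noteq> 0" "k \<noteq> 1" using k \<open>u \<noteq> z\<close> \<open>z \<noteq> w\<close> by metis+
      then have "k \<ge> 2" by simp
      have "cyclic_list E (take (Suc k) vs)"
        unfolding cyclic_list_def
      proof (intro conjI allI impI)
        show "distinct (take (Suc k) vs)" using vs(1) by (simp add: P_def)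
        fix i assume i: "i < length (take (Suc k) vs)"
        have len: "length (take (Suc k) vs) = Suc k" using k by simp
        show "(take (Suc k) vs ! i, take (Suc k) vs ! (Suc i mod length (take (Suc k) vs))) \<in> E"
        proof (cases "i = k")
          case True
          then show ?thesis using k sym vs01(1) unfolding len by simp
        next
          case False
          then have "i < k" using i len by simp
          then have "(vs ! i, vs ! Suc i) \<in> E" using vs(1) k by (simp add: P_def)
          then show ?thesis using \<open>i < k\<close> unfolding len by simp
        qed
      qed
      then show False using T(7)[of "take (Suc k) vs"] \<open>k \<ge> 2\<close> k by auto
    qed
  qed
  moreover have "(u, w) \<in> E" using vs(1) by (auto simp: P_def us)
  ultimately have "E `` {u} = {w}" by blast
  then show ?thesis by (auto simp: leaves_def)
qed

section \<open>Cayley's formula\<close>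

text \<open>Expanding the product of \<open>(-1) + 1\<close> over \<open>L\<close> gives one summand
  for each subset.\<close>

lemma sum_signed_subsets:
  assumes "finite L" "L \<noteq> {}"
  shows "(\<Sum>S\<in>Pow L. (-1) ^ card S) = (0 :: int)"
proof -
  have "(\<Sum>S\<in>Pow L. (-1) ^ card S) = (\<Prod>x\<in>L. (-1) + (1 :: int))"
    using assms by (subst prod_add) simp_all
  also have "\<dots> = 0" using assms by (simp add: power_0_left)
  finally show ?thesis .
qed

text \<open>Inclusion-exclusion: the empty set contributes the cardinality to an alternating sum
  that vanishes.\<close>

lemma card_eq_if_superset_counts_eq:
  assumes fin: "finite A" "finite B" "finite V"
    and L: "\<And>x. x \<in> A \<Longrightarrow> L x \<subseteq> V \<and> L x \<noteq> {}"
    and M: "\<And>y. y \<in> B \<Longrightarrow> M y \<subseteq> V \<and> M y \<noteq> {}"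
    and eq: "\<And>S. S \<subseteq> V \<Longrightarrow> S \<noteq> {} \<Longrightarrow> card {x \<in> A. S \<subseteq> L x} = card {y \<in> B. S \<subseteq> M y}"
  shows "card A = card B"
proof -
  have *: "int (card X) = - (\<Sum>S\<in>Pow V - {{}}. (-1) ^ card S * int (card {x \<in> X. S \<subseteq> f x}))"
    if X: "finite X" "\<And>x. x \<in> X \<Longrightarrow> f x \<subseteq> V \<and> f x \<noteq> {}" for X :: "'x set" and f
  proof -
    have "(\<Sum>S\<in>Pow V. (-1) ^ card S * int (card {x \<in> X. S \<subseteq> f x})) =
        (\<Sum>S\<in>Pow V. \<Sum>x | x \<in> X \<and> S \<subseteq> f x. (-1) ^ card S)"
      by (simp add: mult.commute)
    \<comment> \<open>After the exchange, \<open>S\<close> runs for fixed \<open>x\<close> over all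
      subsets of the nonempty set \<open>f x\<close>, and their signs cancel.\<close>
    also have "\<dots> = (\<Sum>x\<in>X. \<Sum>S | S \<in> Pow V \<and> S \<subseteq> f x. (-1) ^ card S)"
      using X fin by (intro sum.swap_restrict) auto
    also have "\<dots> = (\<Sum>x\<in>X. 0)"
    proof (intro sum.cong refl)
      fix x assume x: "x \<in> X"
      then have "{S. S \<in> Pow V \<and> S \<subseteq> f x} = Pow (f x)" using X(2)[of x] by blast
      moreover have "finite (f x)" using X(2)[OF x] fin finite_subset by blast
      ultimately show "(\<Sum>S | S \<in> Pow V \<and> S \<subseteq> f x. (-1) ^ card S) = (0 :: int)"
        using sum_signed_subsets[of "f x"] X(2)[OF x] by simp
    qed
    finally show ?thesis
      using fin by (simp add: sum.remove[of "Pow V" "{}"])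
  qed
  have "int (card A) = - (\<Sum>S\<in>Pow V - {{}}. (-1) ^ card S * int (card {x \<in> A. S \<subseteq> L x}))"
    by (rule *) (use fin L in auto)
  also have "\<dots> = - (\<Sum>S\<in>Pow V - {{}}. (-1) ^ card S * int (card {y \<in> B. S \<subseteq> M y}))"
    by (intro arg_cong[where f = uminus] sum.cong refl) (simp add: eq)
  also have "\<dots> = int (card B)"
    by (rule *[symmetric]) (use fin M in auto)
  finally show ?thesis by simp
qed

section \<open>Trees with prescribed leaves\<close>

definition trees_on :: "'a set \<Rightarrow> 'a rel set" where
  "trees_on V = {E. tree_on V E}"

lemma finite_trees_on: "finite V \<Longrightarrow> finite (trees_on V)"
  by (rule finite_subset[of _ "Pow (V \<times> V)"]) (auto simp: trees_on_def dest: tree_onD(3))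

lemma attach_Image:
  assumes "E \<subseteq> W \<times> W" "l \<notin> W"
  shows "p \<noteq> l \<Longrightarrow> attach l p E `` {l} = {p}"
    "x \<noteq> l \<Longrightarrow> x \<noteq> p \<Longrightarrow> attach l p E `` {x} = E `` {x}"
    "p \<noteq> l \<Longrightarrow> attach l p E `` {p} = insert l (E `` {p})"
  using assms by (auto simp: attach_def)

lemma inj_on_attach: "l \<notin> W \<Longrightarrow> inj_on (attach l p) (trees_on W)"
proof (rule inj_onI)
  fix E F assume l: "l \<notin> W" and EF: "E \<in> trees_on W" "F \<in> trees_on W" "attach l p E = attach l p F"
  have "(l, p) \<notin> E" "(p, l) \<notin> E" "(l, p) \<notin> F" "(p, l) \<notin> F"
    using EF l by (auto simp: trees_on_def dest: tree_onD(3))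
  then show "E = F" using EF(3) by (auto simp: attach_def)
qed

lemma trees_on_eq_attach:
  assumes "l \<notin> W" "p \<in> W"
  shows "{E \<in> trees_on (insert l W). E `` {l} = {p}} = attach l p ` trees_on W"
proof (intro equalityI subsetI)
  fix E assume "E \<in> {E \<in> trees_on (insert l W). E `` {l} = {p}}"
  then show "E \<in> attach l p ` trees_on W"
    using tree_on_detach(2,3)[of l W E p] assms by (metis (mono_tags) image_eqI mem_Collect_eq trees_on_def)
next
  fix E assume "E \<in> attach l p ` trees_on W"
  then obtain E' where E': "tree_on W E'" "E = attach l p E'" by (auto simp: trees_on_def)
  moreover have "p \<noteq> l" using assms by auto
  ultimately show "E \<in> {E \<in> trees_on (insert l W). E `` {l} = {p}}"
    using tree_on_attach[OF E'(1) assms(2,1)] attach_Image(1)[OF tree_onD(3)[OF E'(1)] assms(1)]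
    by (simp add: trees_on_def)
qed

text \<open>Two adjacent leaves form a closed set.\<close>

lemma tree_on_adjacent_leaves:
  assumes T: "tree_on V E" and l: "E `` {l} = {p}" and p: "p \<in> leaves E"
  shows "V = {l, p}"
proof -
  have lp: "(l, p) \<in> E" using l by auto
  then have "(p, l) \<in> E" using tree_onD(4)[OF T] by (auto simp: sym_def)
  then have "l \<in> E `` {p}" by simp
  moreover obtain q where q: "E `` {p} = {q}" using p by (auto simp: leaves_def)
  ultimately have "E `` {p} = {l}" by simp
  then have "E `` {l, p} \<subseteq> {l, p}" using l by blast
  moreover have "{l, p} \<subseteq> V" using lp tree_onD(3)[OF T] by auto
  ultimately show ?thesis using tree_onD(6)[OF T, of "{l, p}"] by simp
qed

text \<open>Each prescribed leaf chooses its neighbour freely in \<open>V - S\<close>: a neighbour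
  inside \<open>S\<close> would be an adjacent leaf and exhaust the tree, while \<open>S\<close> is
  a proper subset. Since the neighbour of a removed leaf is outside \<open>S\<close>, the other
  prescribed leaves remain leaves, and induction applies.\<close>

lemma card_trees_on_leaves_superset:
  assumes "finite V" "S \<subset> V"
  shows "card {E \<in> trees_on V. S \<subseteq> leaves E} = (card V - card S) ^ card S * card (trees_on (V - S))"
proof -
  have "finite S" using assms finite_subset by blast
  then show ?thesis
    using assms
  proof (induction S arbitrary: V)
    case (insert l S)
    define W where "W = V - {l}"
    have W: "finite W" "l \<notin> W" "insert l W = V" "S \<subset> W"
      using insert by (auto simp: W_def)
    let ?A = "{E \<in> trees_on W. S \<subseteq> leaves E}"
    have sub: "E \<subseteq> W \<times> W" if "E \<in> ?A" for E
      using that tree_onD(3) by (auto simp: trees_on_def)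
    have "{E \<in> trees_on V. insert l S \<subseteq> leaves E} = (\<Union>p\<in>W - S. attach l p ` ?A)"
    proof (intro equalityI subsetI)
      fix E assume E: "E \<in> {E \<in> trees_on V. insert l S \<subseteq> leaves E}"
      then obtain p where p: "E `` {l} = {p}" by (auto simp: leaves_def)
      have T: "tree_on (insert l W) E" using E W by (simp add: trees_on_def)
      have "p \<in> W" using tree_on_detach(1)[OF T W(2) p] .
      have "p \<notin> S"
        using tree_on_adjacent_leaves[OF T p] E W insert.prems insert.hyps by blast
      have "E \<in> attach l p ` trees_on W"
        using trees_on_eq_attach[OF W(2) \<open>p \<in> W\<close>] T p by (auto simp: trees_on_def)
      then obtain F where F: "F \<in> trees_on W" "E = attach l p F" by auto
      have "F `` {s} = E `` {s}" if "s \<in> S" for s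
      proof -
        have "s \<noteq> l" "s \<noteq> p" using that \<open>p \<notin> S\<close> insert.hyps(2) by auto
        moreover have "F \<subseteq> W \<times> W" using F tree_onD(3) by (auto simp: trees_on_def)
        ultimately show ?thesis using attach_Image(2)[of F W l s p] F W by simp
      qed
      then have "S \<subseteq> leaves F" using E by (auto simp: leaves_def)
      then show "E \<in> (\<Union>p\<in>W - S. attach l p ` ?A)" using F \<open>p \<in> W\<close> \<open>p \<notin> S\<close> by blast
    next
      fix E assume "E \<in> (\<Union>p\<in>W - S. attach l p ` ?A)"
      then obtain p F where F: "p \<in> W" "p \<notin> S" "F \<in> ?A" "E = attach l p F" by blast
      have "E \<in> trees_on V \<and> E `` {l} = {p}"
        using trees_on_eq_attach[OF W(2) F(1)] F W by auto
      moreover have "E `` {s} = F `` {s}" if "s \<in> S" for s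
        using attach_Image(2)[OF sub[OF F(3)] W(2), of s p] F(2,4) that insert.hyps(2) by metis
      ultimately show "E \<in> {E \<in> trees_on V. insert l S \<subseteq> leaves E}"
        using F(3) by (auto simp: leaves_def)
    qed
    \<comment> \<open>The tree determines \<open>p\<close> as the neighbour of
      \<open>l\<close>.\<close>
    moreover have "attach l p ` ?A \<inter> attach l q ` ?A = {}" if "p \<noteq> q" "p \<in> W" "q \<in> W" for p q
    proof -
      have "attach l r F `` {l} = {r}" if "F \<in> ?A" "r \<in> W" for r F
        using attach_Image(1)[OF sub[OF that(1)] W(2), of r] that(2) W(2) by auto
      then show ?thesis using that by (smt (verit) disjoint_iff image_iff singleton_inject)
    qed
    moreover have "card (attach l p ` ?A) = card ?A" for p
      by (rule card_image) (rule inj_on_subset[OF inj_on_attach[OF W(2)]], auto)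
    moreover have "finite ?A" using finite_trees_on[OF W(1)] by simp
    ultimately have "card {E \<in> trees_on V. insert l S \<subseteq> leaves E} = (\<Sum>p\<in>W - S. card ?A)"
      using W(1) by (simp only:) (subst card_UN_disjoint, auto)
    also have "\<dots> = (card W - card S) * ((card W - card S) ^ card S * card (trees_on (W - S)))"
      using insert.IH[OF W(1,4)] W(4) insert.hyps(1) by (simp add: card_Diff_subset less_imp_le)
    also have "card W = card V - 1" using W by auto
    also have "W - S = V - insert l S" by (auto simp: W_def)
    finally show ?case using insert.hyps by simp
  qed simp
qed

lemma trees_on_singleton: "trees_on {v} = {{}}"
proof (intro equalityI subsetI)
  fix E assume "E \<in> trees_on {v}"
  then show "E \<in> {{}}"
    using tree_onD(3,5)[of "{v}" E] by (auto simp: trees_on_def irrefl_def)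
next
  have "length vs < 3" if "cyclic_list {} vs" for vs :: "'a list"
    using that by (cases vs) (auto simp: cyclic_list_def)
  then show "E \<in> trees_on {v}" if "E \<in> {{}}" for E
    using that by (auto simp: trees_on_def tree_on_def sym_def irrefl_def)
qed

text \<open>Cayley's formula. As in Pruefer's correspondence, the leaves of a tree behave like the
  letters missing from a word of length \<open>n - 2\<close>.\<close>

theorem card_trees_on:
  assumes "finite V" "V \<noteq> {}"
  shows "card (trees_on V) = card V ^ (card V - 2)"
  using assms
proof (induction "card V" arbitrary: V rule: less_induct)
  case (less V)
  have IH: "card {E \<in> trees_on V. S \<subseteq> leaves E} = (card V - card S) ^ (card V - 2)"
    if S: "S \<subset> V" "S \<noteq> {}" for S
  proof -
    have "finite S" using S less.prems finite_subset by blast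
    then have "card S > 0" "card S < card V" using S less.prems by (auto simp: psubset_card_mono)
    have VS: "card (V - S) = card V - card S" using S \<open>finite S\<close> by (simp add: card_Diff_subset less_imp_le)
    have "card (trees_on (V - S)) = (card V - card S) ^ (card V - card S - 2)"
      using less.hyps[of "V - S"] S less.prems \<open>card S > 0\<close> \<open>card S < card V\<close> VS by auto
    then have "card {E \<in> trees_on V. S \<subseteq> leaves E} =
        (card V - card S) ^ (card S + (card V - card S - 2))"
      using card_trees_on_leaves_superset[OF less.prems(1) S(1)] by (simp add: power_add)
    \<comment> \<open>The exponents add up unless \<open>V - S\<close> is a singleton, where the
      subtraction is truncated; but there the base is 1.\<close>
    also have "\<dots> = (card V - card S) ^ (card V - 2)"
      using \<open>card S < card V\<close> by (cases "card V = Suc (card S)") auto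
    finally show ?thesis .
  qed
  have "card V > 0" using less.prems by (simp add: card_gt_0_iff)
  then consider "card V = 1" | "card V = 2" | "card V \<ge> 3" by linarith
  then show ?case
  proof cases
    case 1
    then show ?thesis by (auto simp: card_1_singleton_iff trees_on_singleton)
  next
    case 2
    then obtain u v where uv: "V = {u, v}" "u \<noteq> v" by (auto simp: card_2_iff)
    \<comment> \<open>With two vertices \<open>u\<close> is a leaf of every tree, so the count for
      \<open>S = {u}\<close> already covers them all.\<close>
    have "u \<in> leaves E" if E: "E \<in> trees_on V" for E
    proof -
      note T = tree_onD[of V E]
      have "E `` {u} \<subseteq> {v}" using E T(3,5) uv by (auto simp: trees_on_def irrefl_def)
      moreover have "E `` {u} \<noteq> {}" using E T(6)[of "{u}"] uv by (auto simp: trees_on_def)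
      ultimately have "E `` {u} = {v}" by blast
      then show ?thesis by (auto simp: leaves_def)
    qed
    then have "{E \<in> trees_on V. {u} \<subseteq> leaves E} = trees_on V" by auto
    then show ?thesis using IH[of "{u}"] uv 2 by auto
  next
    case 3
    let ?B = "{w. set w \<subseteq> V \<and> length w = card V - 2}"
    have "card (trees_on V) = card ?B"
    proof (rule card_eq_if_superset_counts_eq[where L = leaves and M = "\<lambda>w. V - set w"])
      show "finite (trees_on V)" "finite ?B" "finite V"
        using less.prems finite_trees_on finite_lists_length_eq by auto
      show "leaves E \<subseteq> V \<and> leaves E \<noteq> {}" if "E \<in> trees_on V" for E
        using that leaves_subset[of V E] tree_on_has_leaf[of V E] 3 by (auto simp: trees_on_def)
      show "V - set w \<subseteq> V \<and> V - set w \<noteq> {}" if "w \<in> ?B" for w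
      proof -
        \<comment> \<open>A word of this length is too short to use every letter.\<close>
        have "card (set w) \<le> card V - 2" using that card_length[of w] by simp
        then have "card (set w) < card V" using 3 by linarith
        then show ?thesis using card_mono[of "set w" V] by auto
      qed
      fix S assume S: "S \<subseteq> V" "S \<noteq> {}"
      have "{w \<in> ?B. S \<subseteq> V - set w} = {w. set w \<subseteq> V - S \<and> length w = card V - 2}"
        using S by blast
      then have words: "card {w \<in> ?B. S \<subseteq> V - set w} = (card V - card S) ^ (card V - 2)"
        using S less.prems finite_subset[OF S(1)]
        by (simp add: card_lists_length_eq card_Diff_subset)
      show "card {E \<in> trees_on V. S \<subseteq> leaves E} = card {w \<in> ?B. S \<subseteq> V - set w}"
      proof (cases "S = V")
        case False
        then show ?thesis using IH[of S] S words by auto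
      next
        case True
        \<comment> \<open>For \<open>S = V\<close> both counts vanish: a tree consisting of leaves
          has just two vertices, and a nonempty word needs a letter.\<close>
        have "\<not> V \<subseteq> leaves E" if E: "tree_on V E" for E
        proof
          assume V: "V \<subseteq> leaves E"
          obtain l where "l \<in> V" using less.prems by auto
          then obtain p where p: "E `` {l} = {p}" using V by (auto simp: leaves_def)
          then have "p \<in> V" using tree_onD(3)[OF E] by auto
          then have "V = {l, p}" using tree_on_adjacent_leaves[OF E p] V by auto
          then show False using 3 card_insert_le_m1[of 2 "{p}" l] by simp
        qed
        then have none: "{E \<in> trees_on V. S \<subseteq> leaves E} = {}"
          using True by (auto simp: trees_on_def)
        show ?thesis unfolding none words using True 3 by simp
      qed
    qed
    then show ?thesis using less.prems by (simp add: card_lists_length_eq)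
  qed
qed

section \<open>Counting pendant paths\<close>

text \<open>The triple is ordered from the leaf inwards. The exit \<open>d\<close> is the remaining
  neighbour of \<open>c\<close>, hence determined and not recorded.\<close>

definition pendant_paths :: "'a rel \<Rightarrow> ('a \<times> 'a \<times> 'a) set" where
  "pendant_paths E = {(a, b, c). \<exists>d. distinct [a, b, c, d] \<and>
     E `` {a} = {b} \<and> E `` {b} = {a, c} \<and> E `` {c} = {b, d}}"

section \<open>Cutting off and reattaching a pendant path\<close>

definition attach_path :: "'a \<Rightarrow> 'a \<Rightarrow> 'a \<Rightarrow> 'a \<Rightarrow> 'a rel \<Rightarrow> 'a rel" where
  "attach_path a b c d E = attach a b (attach b c (attach c d E))"

lemma tree_on_leafE:
  assumes "tree_on (insert l W) E" "l \<notin> W" "E `` {l} = {p}"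
  obtains F where "tree_on W F" "p \<in> W" "E = attach l p F" "F `` {p} = E `` {p} - {l}"
    "\<And>x. x \<noteq> l \<Longrightarrow> x \<noteq> p \<Longrightarrow> F `` {x} = E `` {x}"
proof -
  let ?F = "E - {(l, p), (p, l)}"
  have F: "p \<in> W" "tree_on W ?F" "E = attach l p ?F"
    using tree_on_detach[OF assms] by simp_all
  show thesis
  proof (rule that[OF F(2,1,3)])
    show "?F `` {p} = E `` {p} - {l}" using F(1) assms(2) by auto
    show "?F `` {x} = E `` {x}" if "x \<noteq> l" "x \<noteq> p" for x using that by auto
  qed
qed

lemma tree_on_attach_path:
  assumes F: "tree_on W F" and d: "d \<in> W" and abc: "distinct [a, b, c]" "a \<notin> W" "b \<notin> W" "c \<notin> W"
  shows "tree_on (insert a (insert b (insert c W))) (attach_path a b c d F)"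
    "attach_path a b c d F `` {a} = {b}"
    "attach_path a b c d F `` {b} = {a, c}"
    "attach_path a b c d F `` {c} = {b, d}"
    "\<And>x. x \<in> W \<Longrightarrow> x \<noteq> d \<Longrightarrow> attach_path a b c d F `` {x} = F `` {x}"
proof -
  let ?E1 = "attach c d F" let ?E2 = "attach b c ?E1" let ?E3 = "attach a b ?E2"
  have T1: "tree_on (insert c W) ?E1" using F d abc by (intro tree_on_attach) auto
  then have T2: "tree_on (insert b (insert c W)) ?E2" by (rule tree_on_attach) (use abc in auto)
  then show "tree_on (insert a (insert b (insert c W))) (attach_path a b c d F)"
    unfolding attach_path_def by (rule tree_on_attach) (use abc in auto)
  note s = tree_onD(3)[OF F] tree_onD(3)[OF T1] tree_onD(3)[OF T2]
  have "d \<noteq> c" using abc d by auto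
  then have 1: "?E1 `` {c} = {d}" using attach_Image(1)[OF s(1), of c d] abc by simp
  have 2: "?E2 `` {b} = {c}" "?E2 `` {c} = {b, d}"
    using attach_Image(1,3)[OF s(2), of b c] 1 abc by auto
  have a: "a \<notin> insert b (insert c W)" "b \<noteq> a" "c \<noteq> a" "c \<noteq> b" using abc by auto
  show "attach_path a b c d F `` {a} = {b}"
    unfolding attach_path_def by (rule attach_Image(1)[OF s(3) a(1,2)])
  show "attach_path a b c d F `` {b} = {a, c}"
    unfolding attach_path_def attach_Image(3)[OF s(3) a(1,2)] 2(1) by simp
  show "attach_path a b c d F `` {c} = {b, d}"
    unfolding attach_path_def attach_Image(2)[OF s(3) a(1,3,4)] 2(2) by simp
  show "attach_path a b c d F `` {x} = F `` {x}" if "x \<in> W" "x \<noteq> d" for x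
  proof -
    have x: "x \<noteq> a" "x \<noteq> b" "x \<noteq> c" and b: "b \<notin> insert c W" using that abc by auto
    show ?thesis
      unfolding attach_path_def attach_Image(2)[OF s(3) a(1) x(1,2)]
        attach_Image(2)[OF s(2) b x(2,3)] attach_Image(2)[OF s(1) abc(4) x(3) that(2)] ..
  qed
qed

text \<open>Once \<open>a\<close> is cut off, \<open>b\<close> is a leaf, and after it
  \<open>c\<close>; three leaf removals lead to a tree on \<open>W\<close>, in which the exit
  \<open>d\<close> may be any vertex.\<close>

lemma trees_on_eq_attach_path:
  assumes abc: "distinct [a, b, c]" "a \<notin> W" "b \<notin> W" "c \<notin> W"
  shows "{E \<in> trees_on (insert a (insert b (insert c W))). (a, b, c) \<in> pendant_paths E} =
    (\<Union>d\<in>W. attach_path a b c d ` trees_on W)"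
proof (intro equalityI subsetI)
  fix E assume "E \<in> {E \<in> trees_on (insert a (insert b (insert c W))). (a, b, c) \<in> pendant_paths E}"
  then obtain d where E: "tree_on (insert a (insert b (insert c W))) E"
    and d: "distinct [a, b, c, d]" "E `` {a} = {b}" "E `` {b} = {a, c}" "E `` {c} = {b, d}"
    by (auto simp: trees_on_def pendant_paths_def)
  have "a \<notin> insert b (insert c W)" using abc by auto
  then obtain E2 where E2: "tree_on (insert b (insert c W)) E2" "E = attach a b E2"
    "E2 `` {b} = E `` {b} - {a}" "\<And>x. x \<noteq> a \<Longrightarrow> x \<noteq> b \<Longrightarrow> E2 `` {x} = E `` {x}"
    using tree_on_leafE[OF E _ d(2)] by metis
  have "E2 `` {b} = {c}" using E2(3) d by auto
  moreover have "b \<notin> insert c W" using abc by auto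
  ultimately obtain E1 where E1: "tree_on (insert c W) E1" "E2 = attach b c E1"
    "E1 `` {c} = E2 `` {c} - {b}"
    using tree_on_leafE[OF E2(1)] by metis
  have "E1 `` {c} = {d}" using E1(3) E2(4)[of c] d by auto
  then obtain F where F: "tree_on W F" "d \<in> W" "E1 = attach c d F"
    using tree_on_leafE[OF E1(1) abc(4)] by metis
  then have "E = attach_path a b c d F" using E1 E2 by (simp add: attach_path_def)
  then show "E \<in> (\<Union>d\<in>W. attach_path a b c d ` trees_on W)" using F by (auto simp: trees_on_def)
next
  fix E assume "E \<in> (\<Union>d\<in>W. attach_path a b c d ` trees_on W)"
  then obtain d F where F: "d \<in> W" "tree_on W F" "E = attach_path a b c d F"
    by (auto simp: trees_on_def)
  have "distinct [a, b, c, d]" using abc F(1) by auto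
  then show "E \<in> {E \<in> trees_on (insert a (insert b (insert c W))). (a, b, c) \<in> pendant_paths E}"
    using tree_on_attach_path(1-4)[OF F(2,1) abc] unfolding F(3)
    by (auto simp: trees_on_def pendant_paths_def)
qed

text \<open>No tree is counted twice: it determines \<open>d\<close> as the second neighbour of
  \<open>c\<close>, and \<open>F\<close> as its restriction to \<open>W \<times> W\<close>.\<close>

lemma sum_trees_on_pendant_path:
  fixes f :: "'a rel \<Rightarrow> nat"
  assumes W: "finite W" and abc: "distinct [a, b, c]" "a \<notin> W" "b \<notin> W" "c \<notin> W"
  shows "(\<Sum>E | E \<in> trees_on (insert a (insert b (insert c W))) \<and> (a, b, c) \<in> pendant_paths E. f E) =
    (\<Sum>d\<in>W. \<Sum>F\<in>trees_on W. f (attach_path a b c d F))"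
proof -
  have "(\<Sum>E | E \<in> trees_on (insert a (insert b (insert c W))) \<and> (a, b, c) \<in> pendant_paths E. f E) =
      (\<Sum>d\<in>W. \<Sum>E\<in>attach_path a b c d ` trees_on W. f E)"
    unfolding trees_on_eq_attach_path[OF abc]
  proof (rule sum.UNION_disjoint)
    show "\<forall>d\<in>W. \<forall>d'\<in>W. d \<noteq> d' \<longrightarrow>
        attach_path a b c d ` trees_on W \<inter> attach_path a b c d' ` trees_on W = {}"
    proof (intro ballI impI, rule ccontr)
      fix d d' assume d: "d \<in> W" "d' \<in> W" "d \<noteq> d'"
        and "attach_path a b c d ` trees_on W \<inter> attach_path a b c d' ` trees_on W \<noteq> {}"
      then obtain F F' where F: "tree_on W F" "tree_on W F'"
        "attach_path a b c d F = attach_path a b c d' F'" by (auto simp: trees_on_def)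
      have "{b, d} = {b, d'}"
        using tree_on_attach_path(4)[OF F(1) d(1) abc] tree_on_attach_path(4)[OF F(2) d(2) abc] F(3)
        by simp
      then show False using d(3) by (simp add: doubleton_eq_iff)
    qed
  qed (use W finite_trees_on in auto)
  also have "\<dots> = (\<Sum>d\<in>W. \<Sum>F\<in>trees_on W. f (attach_path a b c d F))"
  proof (rule sum.cong[OF refl])
    fix d assume "d \<in> W"
    have "inj_on (attach_path a b c d) (trees_on W)"
    proof (rule inj_on_inverseI[where g = "\<lambda>E. E \<inter> W \<times> W"])
      fix F assume "F \<in> trees_on W"
      then have "F \<subseteq> W \<times> W" by (auto simp: trees_on_def dest: tree_onD(3))
      then show "attach_path a b c d F \<inter> W \<times> W = F"
        using abc by (auto simp: attach_path_def attach_def)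
    qed
    then show "(\<Sum>E\<in>attach_path a b c d ` trees_on W. f E) =
        (\<Sum>F\<in>trees_on W. f (attach_path a b c d F))"
      by (simp add: sum.reindex)
  qed
  finally show ?thesis .
qed

text \<open>Two pendant paths can only overlap if they make up the whole tree.\<close>

lemma pendant_paths_disjoint:
  assumes T: "tree_on V E" and V: "card V \<ge> 7"
    and abc: "distinct [a, b, c, d]" "E `` {a} = {b}" "E `` {b} = {a, c}" "E `` {c} = {b, d}"
    and xyz: "distinct [x, y, z, u]" "E `` {x} = {y}" "E `` {y} = {x, z}" "E `` {z} = {y, u}"
    and neq: "(a, b, c) \<noteq> (x, y, z)"
  shows "{a, b, c} \<inter> {x, y, z} = {}" "d \<notin> {x, y, z}"
proof -
  let ?U = "{a, b, c, x, y, z}"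
  \<comment> \<open>With both exits inside, the union of the paths would be closed, hence the whole
    tree, but it has at most 6 vertices.\<close>
  have du: "d \<notin> ?U \<or> u \<notin> ?U"
  proof (rule ccontr)
    assume du: "\<not> ?thesis"
    have "E `` ?U = E `` {a} \<union> E `` {b} \<union> E `` {c} \<union> E `` {x} \<union> E `` {y} \<union> E `` {z}" by auto
    also have "\<dots> \<subseteq> ?U" unfolding abc(2-4) xyz(2-4) using du by auto
    finally have "E `` ?U \<subseteq> ?U" .
    moreover have "?U \<subseteq> V"
    proof -
      have "v \<in> V" if "E `` {v} \<noteq> {}" for v using that tree_onD(3)[OF T] by auto
      then show ?thesis using abc(2-4) xyz(2-4) by simp
    qed
    ultimately have "?U = V" using tree_onD(6)[OF T, of ?U] by simp
    moreover have "card ?U \<le> 6" by (intro card_insert_le_m1) auto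
    ultimately show False using V by simp
  qed
  \<comment> \<open>Comparing degrees separates the leaves \<open>a\<close> and \<open>x\<close>
    from the inner vertices of the other path.\<close>
  have "card (E `` {a}) = 1" "card (E `` {b}) = 2" "card (E `` {c}) = 2"
    "card (E `` {x}) = 1" "card (E `` {y}) = 2" "card (E `` {z}) = 2"
    unfolding abc(2-4) xyz(2-4) using abc(1) xyz(1) by auto
  then have 1: "a \<noteq> y" "a \<noteq> z" "x \<noteq> b" "x \<noteq> c"
    by (metis one_eq_numeral_iff num.distinct(1))+
  have 2: "a \<noteq> x"
  proof
    assume "a = x"
    then have "b = y" using abc(2) xyz(2) by simp
    then have "{a, c} = {x, z}" using abc(3) xyz(3) by simp
    then show False using \<open>a = x\<close> \<open>b = y\<close> neq by (simp add: doubleton_eq_iff)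
  qed
  have 3: "b \<noteq> y"
  proof
    assume "b = y"
    then have "{a, c} = {x, z}" using abc(3) xyz(3) by simp
    then show False using 1 2 by (simp add: doubleton_eq_iff)
  qed
  \<comment> \<open>Here and for \<open>c = z\<close> below, the neighbourhoods force both exits
    \<open>d\<close> and \<open>u\<close> into the paths, against \<open>du\<close>.\<close>
  have 4: "b \<noteq> z"
  proof
    assume "b = z"
    then have "{a, c} = {y, u}" using abc(3) xyz(4) by simp
    then have "a = u" "c = y" using 1 by (simp_all add: doubleton_eq_iff)
    then have "{b, d} = {x, z}" using abc(4) xyz(3) by simp
    then have "d = x" using 1 by (simp add: doubleton_eq_iff)
    then show False using \<open>a = u\<close> du by simp
  qed
  have 5: "c \<noteq> y"
  proof
    assume "c = y"
    then have "{b, d} = {x, z}" using abc(4) xyz(3) by simp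
    then show False using 1 4 by (simp add: doubleton_eq_iff)
  qed
  have 6: "c \<noteq> z"
  proof
    assume "c = z"
    then have "{b, d} = {y, u}" using abc(4) xyz(4) by simp
    then have "b = u" "d = y" using 3 by (simp_all add: doubleton_eq_iff)
    then show False using du by simp
  qed
  show disj: "{a, b, c} \<inter> {x, y, z} = {}" using 1 2 3 4 5 6 by auto
  have "d \<in> E `` {c}" using abc by simp
  then have c: "c \<in> E `` {d}" using tree_onD(4)[OF T] by (auto simp: sym_def)
  show "d \<notin> {x, y, z}"
  proof
    \<comment> \<open>The neighbour \<open>c\<close> of \<open>d\<close> would then lie on the other
      path too, unless \<open>d = z\<close> and \<open>c = u\<close>, where both exits are
      inside.\<close>
    assume "d \<in> {x, y, z}"
    then consider "c \<in> {y}" | "c \<in> {x, z}" | "d = z" "c \<in> {y, u}"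
      using c xyz(2-4) by blast
    then show False using 1 5 6 du by cases auto
  qed
qed

text \<open>Any other pendant path of the new tree is disjoint from the new one and avoids
  \<open>d\<close>, so its vertices have the same neighbourhoods in \<open>F\<close>. The bound on
  \<open>W\<close> provides the 7 vertices needed for disjointness.\<close>

lemma pendant_paths_attach_path:
  assumes F: "tree_on W F" "d \<in> W" and abc: "distinct [a, b, c]" "a \<notin> W" "b \<notin> W" "c \<notin> W"
    and W: "card W \<ge> 4"
  shows "pendant_paths (attach_path a b c d F) \<subseteq> insert (a, b, c) (pendant_paths F)"
proof (intro subsetI)
  let ?E = "attach_path a b c d F"
  let ?V = "insert a (insert b (insert c W))"
  note E = tree_on_attach_path[OF F abc]
  fix t assume t: "t \<in> pendant_paths ?E"
  obtain x y z u where xyz: "t = (x, y, z)" "distinct [x, y, z, u]"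
    "?E `` {x} = {y}" "?E `` {y} = {x, z}" "?E `` {z} = {y, u}"
    using t by (auto simp: pendant_paths_def)
  show "t \<in> insert (a, b, c) (pendant_paths F)"
  proof (cases "(a, b, c) = (x, y, z)")
    case False
    have "finite W" using tree_onD(1)[OF F(1)] .
    then have "card ?V \<ge> 7" using abc W by simp
    moreover have "distinct [a, b, c, d]" using abc F(2) by auto
    ultimately have *: "{a, b, c} \<inter> {x, y, z} = {}" "d \<notin> {x, y, z}"
      using pendant_paths_disjoint[OF E(1) _ _ E(2-4) xyz(2-5) False] by blast+
    have "v \<in> ?V" if "?E `` {v} \<noteq> {}" for v using that tree_onD(3)[OF E(1)] by auto
    then have "x \<in> ?V" "y \<in> ?V" "z \<in> ?V" using xyz by simp_all
    then have "x \<in> W" "y \<in> W" "z \<in> W" using * by auto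
    moreover have "x \<noteq> d" "y \<noteq> d" "z \<noteq> d" using *(2) by auto
    ultimately have "F `` {x} = {y}" "F `` {y} = {x, z}" "F `` {z} = {y, u}"
      using E(5) xyz(3-5) by metis+
    then show ?thesis using xyz by (auto simp: pendant_paths_def)
  qed (use xyz in simp)
qed

section \<open>Double counting: first and second moment\<close>

definition triples :: "'a set \<Rightarrow> ('a \<times> 'a \<times> 'a) set" where
  "triples V = {(a, b, c). a \<in> V \<and> b \<in> V \<and> c \<in> V \<and> distinct [a, b, c]}"

lemma pendant_paths_subset:
  assumes "tree_on V E"
  shows "pendant_paths E \<subseteq> triples V"
proof -
  have "v \<in> V" if "E `` {v} \<noteq> {}" for v using that tree_onD(3)[OF assms] by auto
  then show ?thesis by (auto simp: pendant_paths_def triples_def)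
qed

lemma card_triples:
  assumes "finite V"
  shows "finite (triples V)" "card (triples V) = card V * (card V - 1) * (card V - 2)"
proof -
  have *: "triples V = (SIGMA a:V. SIGMA b:V - {a}. V - {a, b})" by (auto simp: triples_def)
  show "finite (triples V)" using assms by (auto simp: *)
  have "card (triples V) = (\<Sum>a\<in>V. \<Sum>b\<in>V - {a}. card V - 2)"
  proof -
    have "card (V - {a, b}) = card V - 2" if "a \<in> V" "b \<in> V - {a}" for a b
      using that assms by (subst card_Diff_subset) auto
    then show ?thesis unfolding * using assms by simp
  qed
  also have "\<dots> = card V * (card V - 1) * (card V - 2)" using assms by simp
  finally show "card (triples V) = card V * (card V - 1) * (card V - 2)" .
qed

text \<open>The weight \<open>f\<close> serves both moments: the constant 1 gives the first, and the
  number of pendant paths itself the second.\<close>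

lemma sum_over_pendant_paths:
  fixes f :: "'a rel \<Rightarrow> nat"
  assumes "finite V"
  shows "(\<Sum>E\<in>trees_on V. card (pendant_paths E) * f E) =
    (\<Sum>(a, b, c)\<in>triples V. \<Sum>d\<in>V - {a, b, c}. \<Sum>F\<in>trees_on (V - {a, b, c}).
      f (attach_path a b c d F))"
proof -
  have "(\<Sum>E\<in>trees_on V. card (pendant_paths E) * f E) =
      (\<Sum>E\<in>trees_on V. \<Sum>t | t \<in> triples V \<and> t \<in> pendant_paths E. f E)"
  proof (intro sum.cong refl)
    fix E assume "E \<in> trees_on V"
    then have "{t. t \<in> triples V \<and> t \<in> pendant_paths E} = pendant_paths E"
      using pendant_paths_subset[of V E] by (auto simp: trees_on_def)
    then show "card (pendant_paths E) * f E = (\<Sum>t | t \<in> triples V \<and> t \<in> pendant_paths E. f E)"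
      by simp
  qed
  also have "\<dots> = (\<Sum>t\<in>triples V. \<Sum>E | E \<in> trees_on V \<and> t \<in> pendant_paths E. f E)"
    using assms finite_trees_on card_triples(1) by (intro sum.swap_restrict) auto
  also have "\<dots> = (\<Sum>(a, b, c)\<in>triples V. \<Sum>d\<in>V - {a, b, c}. \<Sum>F\<in>trees_on (V - {a, b, c}).
      f (attach_path a b c d F))"
  proof (intro sum.cong refl)
    fix t assume t: "t \<in> triples V"
    obtain a b c where abc: "t = (a, b, c)" by (cases t)
    have V: "insert a (insert b (insert c (V - {a, b, c}))) = V"
      using t by (auto simp: abc triples_def)
    have "(\<Sum>E | E \<in> trees_on V \<and> (a, b, c) \<in> pendant_paths E. f E) =
        (\<Sum>d\<in>V - {a, b, c}. \<Sum>F\<in>trees_on (V - {a, b, c}). f (attach_path a b c d F))"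
      using sum_trees_on_pendant_path[of "V - {a, b, c}" a b c f] t assms
      unfolding V by (simp add: abc triples_def)
    then show "(\<Sum>E | E \<in> trees_on V \<and> t \<in> pendant_paths E. f E) = (case t of (a, b, c) \<Rightarrow>
        \<Sum>d\<in>V - {a, b, c}. \<Sum>F\<in>trees_on (V - {a, b, c}). f (attach_path a b c d F))"
      by (simp add: abc)
  qed
  finally show ?thesis .
qed

text \<open>Pairs of a tree and a pendant path in it: an ordered triple, \<open>n - 3\<close> exits,
  and by Cayley \<open>(n - 3) ^ (n - 5)\<close> trees on the remaining vertices.\<close>

definition path_total :: "nat \<Rightarrow> nat" where
  "path_total n = n * (n - 1) * (n - 2) * (n - 3) ^ (n - 4)"

lemma card_Diff_triple:
  assumes "finite V" "(a, b, c) \<in> triples V"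
  shows "card (V - {a, b, c}) = card V - 3"
  using assms by (subst card_Diff_subset) (auto simp: triples_def)

lemma sum_card_pendant_paths:
  assumes "finite V" "card V \<ge> 5"
  shows "(\<Sum>E\<in>trees_on V. card (pendant_paths E)) = path_total (card V)"
proof -
  let ?n = "card V"
  have "(\<Sum>E\<in>trees_on V. card (pendant_paths E)) =
      (\<Sum>(a, b, c)\<in>triples V. card (V - {a, b, c}) * card (trees_on (V - {a, b, c})))"
    using sum_over_pendant_paths[OF assms(1), of "\<lambda>_. 1"] by simp
  also have "\<dots> = (\<Sum>t\<in>triples V. (?n - 3) * (?n - 3) ^ (?n - 5))"
  proof (intro sum.cong refl)
    fix t assume t: "t \<in> triples V"
    obtain a b c where abc: "t = (a, b, c)" by (cases t)
    have n: "card (V - {a, b, c}) = ?n - 3" using card_Diff_triple[OF assms(1)] t abc by simp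
    have "V - {a, b, c} \<noteq> {}"
    proof
      assume "V - {a, b, c} = {}"
      then show False using n assms(2) by (simp only: card.empty)
    qed
    then have "card (trees_on (V - {a, b, c})) = (?n - 3) ^ (?n - 5)"
      using card_trees_on[of "V - {a, b, c}"] n assms(1) by simp
    then show "(case t of (a, b, c) \<Rightarrow> card (V - {a, b, c}) * card (trees_on (V - {a, b, c}))) =
        (?n - 3) * (?n - 3) ^ (?n - 5)" using n by (simp add: abc)
  qed
  also have "\<dots> = card (triples V) * (?n - 3) ^ (Suc (?n - 5))" by simp
  \<comment> \<open>The factor for the exit merges with Cayley's power; \<open>n \<ge> 5\<close>
    rules out truncation.\<close>
  also have "Suc (?n - 5) = ?n - 4" using assms(2) by simp
  finally show ?thesis by (simp add: path_total_def card_triples[OF assms(1)])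
qed

text \<open>One factor of the square is expanded over the pendant paths; the other is at most 1 plus
  the number of pendant paths of the smaller tree. Summing the latter is the first moment for
  \<open>n - 3\<close>, which is at least 5.\<close>

lemma sum_card_pendant_paths_square:
  assumes "finite V" "card V \<ge> 8"
  shows "(\<Sum>E\<in>trees_on V. (card (pendant_paths E))\<^sup>2) \<le>
    card V * (card V - 1) * (card V - 2) * (card V - 3) *
      ((card V - 3) ^ (card V - 5) + path_total (card V - 3))"
proof -
  let ?n = "card V"
  have "(\<Sum>E\<in>trees_on V. (card (pendant_paths E))\<^sup>2) =
      (\<Sum>(a, b, c)\<in>triples V. \<Sum>d\<in>V - {a, b, c}. \<Sum>F\<in>trees_on (V - {a, b, c}).
        card (pendant_paths (attach_path a b c d F)))"
    unfolding power2_eq_square by (rule sum_over_pendant_paths[OF assms(1)])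
  also have "\<dots> \<le> (\<Sum>t\<in>triples V. (?n - 3) * ((?n - 3) ^ (?n - 5) + path_total (?n - 3)))"
  proof (rule sum_mono)
    fix t assume t: "t \<in> triples V"
    obtain a b c where abc: "t = (a, b, c)" by (cases t)
    let ?W = "V - {a, b, c}"
    have n: "card ?W = ?n - 3" using card_Diff_triple[OF assms(1)] t abc by simp
    have "?W \<noteq> {}"
    proof
      assume "?W = {}"
      then show False using n assms(2) by (simp only: card.empty)
    qed
    have T: "card (trees_on ?W) = (?n - 3) ^ (?n - 5)"
      using card_trees_on[OF _ \<open>?W \<noteq> {}\<close>] n assms(1) by simp
    have "card (pendant_paths (attach_path a b c d F)) \<le> 1 + card (pendant_paths F)"
      if "d \<in> ?W" "F \<in> trees_on ?W" for d F
    proof -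
      have F: "tree_on ?W F" using that by (simp add: trees_on_def)
      have fin: "finite (pendant_paths F)"
        using finite_subset[OF pendant_paths_subset[OF F]] card_triples(1)[of ?W] assms(1) by simp
      have "pendant_paths (attach_path a b c d F) \<subseteq> insert (a, b, c) (pendant_paths F)"
        using t assms n by (intro pendant_paths_attach_path[OF F that(1)]) (auto simp: abc triples_def)
      then have "card (pendant_paths (attach_path a b c d F)) \<le> card (insert (a, b, c) (pendant_paths F))"
        using fin by (intro card_mono) auto
      also have "\<dots> \<le> 1 + card (pendant_paths F)" by (simp add: card_insert_le_m1)
      finally show ?thesis .
    qed
    then have "(\<Sum>d\<in>?W. \<Sum>F\<in>trees_on ?W. card (pendant_paths (attach_path a b c d F))) \<le>
        (\<Sum>d\<in>?W. \<Sum>F\<in>trees_on ?W. 1 + card (pendant_paths F))"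
      by (intro sum_mono)
    also have "\<dots> = (?n - 3) * ((?n - 3) ^ (?n - 5) + path_total (?n - 3))"
      using sum_card_pendant_paths[of ?W] assms n T by (simp add: sum_Suc)
    finally show "(case t of (a, b, c) \<Rightarrow> \<Sum>d\<in>V - {a, b, c}. \<Sum>F\<in>trees_on (V - {a, b, c}).
        card (pendant_paths (attach_path a b c d F))) \<le>
        (?n - 3) * ((?n - 3) ^ (?n - 5) + path_total (?n - 3))" by (simp add: abc)
  qed
  also have "\<dots> = card V * (card V - 1) * (card V - 2) * (card V - 3) *
      ((card V - 3) ^ (card V - 5) + path_total (card V - 3))"
    by (simp only: sum_constant card_triples(2)[OF assms(1)] mult.assoc of_nat_id)
  finally show ?thesis .
qed

section \<open>Acquisition on pendant paths\<close>

text \<open>Weight can leave the pendant path only through \<open>c\<close>, and \<open>c\<close> can only take over the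
  weight of \<open>{a, b}\<close> after having received the weight of \<open>d\<close>, which closes the exit.\<close>

definition path_holds_weight :: "'a \<Rightarrow> 'a \<Rightarrow> 'a \<Rightarrow> 'a \<Rightarrow> ('a \<Rightarrow> nat) \<Rightarrow> bool" where
  "path_holds_weight a b c d w \<longleftrightarrow>
     (w c = 0 \<and> (w a > 0 \<or> w b > 0)) \<or>
     (w d = 0 \<and> (w a > 0 \<or> w b > 0 \<or> w c > 0)) \<or>
     (w b = 0 \<and> w a > 0) \<or>
     (w a > 0 \<and> w b > 0 \<and> w c = 1) \<or>
     (w b \<ge> 2 \<and> w c = 1)"

text \<open>An empty vertex never receives weight, since the receiver must weigh at least as much as
  the positive giver. So \<open>c\<close>, \<open>d\<close> or \<open>b\<close> once empty stays
  empty and blocks the way out. Before that, \<open>c\<close> has weight 1 and cannot take over a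
  weight of 2 or more from \<open>b\<close>.\<close>

lemma path_holds_weight_transfer:
  assumes inv: "path_holds_weight a b c d w" and move: "acquisition_move G w m"
    and sym: "sym (parcs G)"
    and path: "distinct [a, b, c, d]" "parcs G `` {a} = {b}" "parcs G `` {b} = {a, c}"
      "parcs G `` {c} = {b, d}"
  shows "path_holds_weight a b c d (transfer_weight w m)"
proof -
  obtain v u where m: "m = (v, u)" by (cases m)
  have vu: "(v, u) \<in> parcs G" "0 < w v" "w v \<le> w u"
    using move by (auto simp: m acquisition_move_def)
  have "x \<in> parcs G `` {y} \<longleftrightarrow> y \<in> parcs G `` {x}" for x y using sym by (auto simp: sym_def)
  then have uv: "u \<in> parcs G `` {v}" "v \<in> parcs G `` {u}" using vu(1) by simp_all
  have "v = b" if "u = a" using uv(2) path(2) that by simp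
  moreover have "v = a \<or> v = c" if "u = b" using uv(2) path(3) that by simp
  moreover have "v = b \<or> v = d" if "u = c" using uv(2) path(4) that by simp
  moreover have "u = b" if "v = a" using uv(1) path(2) that by simp
  moreover have "u = a \<or> u = c" if "v = b" using uv(1) path(3) that by simp
  moreover have "u = b \<or> u = d" if "v = c" using uv(1) path(4) that by simp
  \<comment> \<open>Six moves touch the path. Any other move keeps its weights and cannot refill an
    empty \<open>d\<close>.\<close>
  ultimately consider "v = a" "u = b" | "v = b" "u = a" | "v = b" "u = c" | "v = c" "u = b"
    | "v = c" "u = d" | "v = d" "u = c" | "v \<notin> {a, b, c}" "u \<notin> {a, b, c}"
    by blast
  then show ?thesis
    using inv vu path(1)
    by cases (auto simp: path_holds_weight_def m transfer_weight_def)
qed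

lemma path_holds_weight_moves:
  assumes "acquisition_moves G w ms" "path_holds_weight a b c d w" "sym (parcs G)"
    "distinct [a, b, c, d]" "parcs G `` {a} = {b}" "parcs G `` {b} = {a, c}"
    "parcs G `` {c} = {b, d}"
  shows "path_holds_weight a b c d (foldl transfer_weight w ms)"
  using assms(1,2)
proof (induction ms arbitrary: w)
  case (Cons m ms)
  have "path_holds_weight a b c d (transfer_weight w m)"
    by (rule path_holds_weight_transfer[OF Cons.prems(2) _ assms(3-7)]) (use Cons.prems(1) in simp)
  then show ?case using Cons by simp
qed simp

text \<open>The initial weights satisfy the invariant, and each of its disjuncts puts positive
  weight on \<open>a\<close>, \<open>b\<close> or \<open>c\<close>.\<close>

lemma residual_set_meets_pendant_path:
  assumes T: "undirected_tree G" and S: "residual_set G S" and abc: "(a, b, c) \<in> pendant_paths (parcs G)"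
  shows "S \<inter> {a, b, c} \<noteq> {}"
proof -
  have G: "tree_on (pverts G) (parcs G)" using T by (simp add: undirected_tree_iff)
  obtain ms where ms: "acquisition_moves G (\<lambda>_. 1) ms"
    and S: "S = {v \<in> pverts G. foldl transfer_weight (\<lambda>_. 1) ms v > 0}"
    using S by (auto simp: residual_set_def acquisition_protocol_def)
  obtain d where d: "distinct [a, b, c, d]" "parcs G `` {a} = {b}" "parcs G `` {b} = {a, c}"
    "parcs G `` {c} = {b, d}"
    using abc unfolding pendant_paths_def by blast
  have "path_holds_weight a b c d (\<lambda>_. 1)" by (simp add: path_holds_weight_def)
  then have "path_holds_weight a b c d (foldl transfer_weight (\<lambda>_. 1) ms)"
    by (rule path_holds_weight_moves[OF ms _ tree_onD(4)[OF G] d])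
  then obtain v where v: "v \<in> {a, b, c}" "foldl transfer_weight (\<lambda>_. 1) ms v > 0"
    unfolding path_holds_weight_def by fastforce
  have "{a, b, c} \<subseteq> pverts G"
    using subsetD[OF pendant_paths_subset[OF G] abc] by (simp add: triples_def)
  then have "v \<in> S" using v unfolding S by blast
  then show ?thesis using v(1) by blast
qed

text \<open>Choosing a residual vertex on each pendant path is injective because distinct paths are
  disjoint, which requires 7 vertices.\<close>

lemma card_pendant_paths_le_total_acquisition_number:
  assumes T: "undirected_tree G" and n: "card (pverts G) \<ge> 7"
  shows "card (pendant_paths (parcs G)) \<le> total_acquisition_number G"
proof -
  have G: "tree_on (pverts G) (parcs G)" using T by (simp add: undirected_tree_iff)
  have "\<exists>k S. residual_set G S \<and> card S = k"
    using T residual_set_exists unfolding undirected_tree_def by blast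
  then have "\<exists>S. residual_set G S \<and> card S = total_acquisition_number G"
    unfolding total_acquisition_number_def by (rule LeastI_ex)
  then obtain S where S: "residual_set G S" "card S = total_acquisition_number G" by blast
  have "\<forall>t\<in>pendant_paths (parcs G). \<exists>v. v \<in> S \<and> v \<in> (case t of (a, b, c) \<Rightarrow> {a, b, c})"
  proof
    fix t assume t: "t \<in> pendant_paths (parcs G)"
    obtain a b c where abc: "t = (a, b, c)" by (cases t)
    have "S \<inter> {a, b, c} \<noteq> {}"
      by (rule residual_set_meets_pendant_path[OF T S(1)]) (use t abc in simp)
    then show "\<exists>v. v \<in> S \<and> v \<in> (case t of (a, b, c) \<Rightarrow> {a, b, c})" by (auto simp: abc)
  qed
  from bchoice[OF this] obtain f where f: "\<forall>t\<in>pendant_paths (parcs G).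
    f t \<in> S \<and> f t \<in> (case t of (a, b, c) \<Rightarrow> {a, b, c})" ..
  have "inj_on f (pendant_paths (parcs G))"
  proof (rule inj_onI, rule ccontr)
    fix s t assume st: "s \<in> pendant_paths (parcs G)" "t \<in> pendant_paths (parcs G)" "f s = f t" "s \<noteq> t"
    obtain a b c where s: "s = (a, b, c)" by (cases s)
    obtain x y z where t: "t = (x, y, z)" by (cases t)
    obtain d where abc: "distinct [a, b, c, d]" "parcs G `` {a} = {b}" "parcs G `` {b} = {a, c}"
      "parcs G `` {c} = {b, d}"
      using st(1) unfolding s pendant_paths_def by blast
    obtain u where xyz: "distinct [x, y, z, u]" "parcs G `` {x} = {y}" "parcs G `` {y} = {x, z}"
      "parcs G `` {z} = {y, u}"
      using st(2) unfolding t pendant_paths_def by blast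
    have "{a, b, c} \<inter> {x, y, z} = {}"
      by (rule pendant_paths_disjoint(1)[OF G n abc xyz]) (use st(4) s t in simp)
    moreover have "f s \<in> {a, b, c}" "f t \<in> {x, y, z}" using bspec[OF f st(1)] bspec[OF f st(2)] by (simp_all add: s t)
    ultimately show False using st(3) by auto
  qed
  moreover have "finite S"
    using S(1) tree_onD(1)[OF G] by (auto simp: residual_set_def)
  moreover have "f ` pendant_paths (parcs G) \<subseteq> S" using f by (intro image_subsetI) blast
  ultimately show ?thesis unfolding S(2)[symmetric] by (intro card_inj_on_le)
qed

section \<open>The second moment argument\<close>

text \<open>By Cayley's formula this is the average over all trees for
  \<open>n \<ge> 5\<close>.\<close>

definition mean_pendant_paths :: "nat \<Rightarrow> real" where
  "mean_pendant_paths n = path_total n / n ^ (n - 2)"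

lemma mean_pendant_paths_over_n:
  "(\<lambda>n. mean_pendant_paths n / n) \<longlonglongrightarrow> exp (-3)"
proof -
  \<comment> \<open>The quotient is \<open>(1 - 1/n) (1 - 2/n) (1 - 3/n) ^ (n - 4)\<close>. The
    power is completed to exponent \<open>n\<close>, whose limit is \<open>exp (-3)\<close>, and
    four factors tending to 1 are divided out.\<close>
  let ?g = "\<lambda>n. (1 - 1 / real n) * (1 - 2 / real n) * (1 + (-3) / real n) ^ n / (1 - 3 / real n) ^ 4"
  have "?g \<longlonglongrightarrow> (1 - 0) * (1 - 0) * exp (-3) / (1 - 0) ^ 4"
    by (intro tendsto_intros tendsto_exp_limit_sequentially lim_const_over_n) simp
  moreover have "\<forall>\<^sub>F n in sequentially. mean_pendant_paths n / n = ?g n"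
    using eventually_ge_at_top[of 5]
  proof eventually_elim
    case (elim n)
    have "n - 2 = (n - 4) + 2" using elim by simp
    then have e: "real n ^ (n - 2) = real n ^ (n - 4) * (real n)\<^sup>2" by (metis power_add)
    have y: "1 + (-3) / real n = real (n - 3) / n" "1 - 3 / real n = real (n - 3) / n"
      using elim by (simp_all add: of_nat_diff field_simps)
    have "(1 + (-3) / real n) ^ n / (1 - 3 / real n) ^ 4 = (real (n - 3) / n) ^ (n - 4)"
      unfolding y using elim by (intro power_diff[symmetric]) auto
    then have "?g n = (1 - 1 / real n) * (1 - 2 / real n) * (real (n - 3) / n) ^ (n - 4)"
      by (metis times_divide_eq_right)
    also have "\<dots> = (real (n - 1) / n) * (real (n - 2) / n) * (real (n - 3) ^ (n - 4) / n ^ (n - 4))"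
      using elim by (simp add: of_nat_diff field_simps power_divide)
    also have "\<dots> = mean_pendant_paths n / n"
      using elim by (simp add: mean_pendant_paths_def path_total_def e power2_eq_square ac_simps)
    finally show ?case ..
  qed
  then have "\<forall>\<^sub>F n in sequentially. ?g n = mean_pendant_paths n / n"
    by (simp add: eq_commute)
  ultimately show ?thesis using Lim_transform_eventually by fastforce
qed

text \<open>Chebyshev's inequality in counting form; the numerator bounds the variance through the
  second moment.\<close>

lemma few_pendant_paths_ratio_le:
  fixes c :: real
  assumes n: "n \<ge> 8" and c: "c < mean_pendant_paths n"
  defines "\<mu> \<equiv> mean_pendant_paths n"
  shows "card {E \<in> trees_on {1..n}. real (card (pendant_paths E)) < c} / card (trees_on {1..n}) \<le>
    (\<mu> * (1 + mean_pendant_paths (n - 3)) - \<mu>\<^sup>2) / (\<mu> - c)\<^sup>2"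
proof -
  let ?T = "trees_on {1..n}" and ?X = "\<lambda>E. real (card (pendant_paths E))"
  let ?bad = "{E \<in> ?T. ?X E < c}"
  have fin: "finite ?T" by (simp add: finite_trees_on)
  have t: "card ?T = n ^ (n - 2)" using n by (simp add: card_trees_on)
  have pos: "real (card ?T) > 0" unfolding t using n by simp
  have X1: "(\<Sum>E\<in>?T. ?X E) = card ?T * \<mu>"
  proof -
    have "(\<Sum>E\<in>?T. ?X E) = real (path_total n)"
      using sum_card_pendant_paths[of "{1..n}"] n by (simp flip: of_nat_sum)
    then show ?thesis using n t by (simp add: \<mu>_def mean_pendant_paths_def)
  qed
  have X2: "(\<Sum>E\<in>?T. (?X E)\<^sup>2) \<le> card ?T * (\<mu> * (1 + mean_pendant_paths (n - 3)))"
  proof -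
    have "(\<Sum>E\<in>?T. (?X E)\<^sup>2) = real (\<Sum>E\<in>?T. (card (pendant_paths E))\<^sup>2)" by simp
    also have "\<dots> \<le> real (n * (n - 1) * (n - 2) * (n - 3) * ((n - 3) ^ (n - 5) + path_total (n - 3)))"
      using sum_card_pendant_paths_square[of "{1..n}"] n unfolding of_nat_le_iff by simp
    \<comment> \<open>\<open>(n - 3) ^ (n - 5)\<close> is the number of trees on
      \<open>n - 3\<close> vertices; factoring it out turns the total for \<open>n - 3\<close> into
      a mean.\<close>
    also have "\<dots> = real (path_total n) * (1 + mean_pendant_paths (n - 3))"
    proof -
      have e: "n - 4 = Suc (n - 5)" "n - 3 - 2 = n - 5" using n by auto
      show ?thesis
        using n unfolding path_total_def[of n] mean_pendant_paths_def e by (simp add: field_simps)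
    qed
    also have "\<dots> = card ?T * (\<mu> * (1 + mean_pendant_paths (n - 3)))"
      using n t by (simp add: \<mu>_def mean_pendant_paths_def)
    finally show ?thesis .
  qed
  have "card ?bad * (\<mu> - c)\<^sup>2 = (\<Sum>E\<in>?bad. (\<mu> - c)\<^sup>2)" by simp
  \<comment> \<open>A tree below the threshold deviates from the mean by more than
    \<open>\<mu> - c\<close>, which is positive.\<close>
  also have "\<dots> \<le> (\<Sum>E\<in>?bad. (\<mu> - ?X E)\<^sup>2)"
    using c by (intro sum_mono power_mono) (auto simp: \<mu>_def)
  also have "\<dots> \<le> (\<Sum>E\<in>?T. (\<mu> - ?X E)\<^sup>2)" using fin by (intro sum_mono2) auto
  also have "\<dots> = (\<Sum>E\<in>?T. (?X E)\<^sup>2) - 2 * \<mu> * (\<Sum>E\<in>?T. ?X E) + card ?T * \<mu>\<^sup>2"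
    by (simp add: power2_diff sum.distrib sum_subtractf sum_distrib_left mult.assoc mult.commute)
  also have "\<dots> \<le> card ?T * (\<mu> * (1 + mean_pendant_paths (n - 3)) - \<mu>\<^sup>2)"
    using X2 unfolding X1 by (simp add: algebra_simps power2_eq_square)
  finally show ?thesis
    using pos c by (simp add: divide_le_eq le_divide_eq \<mu>_def mult.commute)
qed

section \<open>From arc sets to labelled trees, and the limit\<close>

lemma labelled_trees_eq: "T \<in> labelled_trees n \<longleftrightarrow> pverts T = {1..n} \<and> parcs T \<in> trees_on {1..n}"
  by (auto simp: labelled_trees_def undirected_tree_iff trees_on_def)

lemma bij_betw_parcs_labelled_trees:
  "bij_betw parcs {T \<in> labelled_trees n. P (parcs T)} {E \<in> trees_on {1..n}. P E}"
  by (rule bij_betw_byWitness[where f' = "\<lambda>E. \<lparr>pverts = {1..n}, parcs = E\<rparr>"])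
    (auto simp: labelled_trees_eq)

lemma finite_labelled_trees: "finite (labelled_trees n)"
  using bij_betw_finite[OF bij_betw_parcs_labelled_trees[of n "\<lambda>_. True"]]
  by (simp add: finite_trees_on)

theorem theorem1p3:
  shows "almost_all_trees (\<lambda>n T. real (total_acquisition_number T) \<ge> real n / (3 * exp 3))"
proof -
  let ?c = "1 / (3 * exp 3) :: real"
  let ?\<mu> = mean_pendant_paths
  let ?good = "\<lambda>n. {T \<in> labelled_trees n. real (total_acquisition_number T) \<ge> real n / (3 * exp 3)}"
  let ?ratio = "\<lambda>n. real (card (?good n)) / real (card (labelled_trees n))"
  let ?err = "\<lambda>n. (?\<mu> n * (1 + ?\<mu> (n - 3)) - (?\<mu> n)\<^sup>2) / (?\<mu> n - ?c * n)\<^sup>2"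
  note lim = mean_pendant_paths_over_n
  have lim3: "(\<lambda>n. ?\<mu> (n - 3) / n) \<longlonglongrightarrow> exp (-3)"
  proof -
    have "(\<lambda>n. ?\<mu> (n - 3) / real (n - 3)) \<longlonglongrightarrow> exp (-3)"
      by (rule filterlim_compose[OF lim filterlim_minus_const_nat_at_top])
    then have "(\<lambda>n. ?\<mu> (n - 3) / real (n - 3) * (1 - 3 / n)) \<longlonglongrightarrow> exp (-3) * (1 - 0)"
      by (intro tendsto_intros lim_const_over_n)
    moreover have "\<forall>\<^sub>F n in sequentially.
        ?\<mu> (n - 3) / real (n - 3) * (1 - 3 / n) = ?\<mu> (n - 3) / n"
      using eventually_ge_at_top[of 4] by eventually_elim (simp add: field_simps of_nat_diff)
    ultimately show ?thesis using Lim_transform_eventually by fastforce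
  qed
  \<comment> \<open>The factor 1/3 keeps the threshold a constant proportion below the mean, so the
    Chebyshev denominator grows like \<open>n\<close> squared.\<close>
  have "?c < exp (-3 :: real)" by (simp add: exp_minus field_simps)
  then have large: "\<forall>\<^sub>F n in sequentially. ?\<mu> n / n > ?c"
    using lim by (rule order_tendstoD(1)[rotated])
  have err: "?err \<longlonglongrightarrow> 0"
  proof -
    \<comment> \<open>Numerator and denominator are divided by \<open>n\<close> squared. In the
      limit the numerator is \<open>exp (-3) * exp (-3) - (exp (-3))\<^sup>2 = 0\<close>, while the
      denominator stays positive.\<close>
    let ?h = "\<lambda>n. (?\<mu> n / n * (1 / n + ?\<mu> (n - 3) / n) - (?\<mu> n / n)\<^sup>2) / (?\<mu> n / n - ?c)\<^sup>2"
    have "?h \<longlonglongrightarrow> (exp (-3) * (0 + exp (-3)) - (exp (-3))\<^sup>2) / (exp (-3) - ?c)\<^sup>2"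
      using \<open>?c < exp (-3)\<close> by (intro tendsto_intros lim lim3 lim_const_over_n) simp
    moreover have "\<forall>\<^sub>F n in sequentially. ?h n = ?err n"
      using eventually_gt_at_top[of 0]
    proof eventually_elim
      case (elim n)
      have "?err n = ((?\<mu> n * (1 + ?\<mu> (n - 3)) - (?\<mu> n)\<^sup>2) / (real n)\<^sup>2) / ((?\<mu> n - ?c * n)\<^sup>2 / (real n)\<^sup>2)"
        using elim by simp
      also have "(?\<mu> n - ?c * n)\<^sup>2 / (real n)\<^sup>2 = (?\<mu> n / n - ?c)\<^sup>2"
        using elim by (simp add: diff_divide_distrib flip: power_divide)
      also have "(?\<mu> n * (1 + ?\<mu> (n - 3)) - (?\<mu> n)\<^sup>2) / (real n)\<^sup>2 =
          ?\<mu> n / n * (1 / n + ?\<mu> (n - 3) / n) - (?\<mu> n / n)\<^sup>2"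
        by (simp add: power2_eq_square diff_divide_distrib add_divide_distrib distrib_left)
      finally show ?case ..
    qed
    ultimately have "?err \<longlonglongrightarrow> (exp (-3) * (0 + exp (-3)) - (exp (-3))\<^sup>2) / (exp (-3) - ?c)\<^sup>2"
      by (rule Lim_transform_eventually)
    then show ?thesis by (simp add: power2_eq_square)
  qed
  have lower: "\<forall>\<^sub>F n in sequentially. 1 - ?err n \<le> ?ratio n"
    using large eventually_ge_at_top[of 8]
  proof eventually_elim
    case (elim n)
    let ?T = "trees_on {1..n}"
    let ?bad = "{E \<in> ?T. real (card (pendant_paths E)) < ?c * n}"
    let ?many = "{E \<in> ?T. \<not> real (card (pendant_paths E)) < ?c * n}"
    have c: "?c * n < ?\<mu> n" using elim by (simp add: field_simps)
    have t: "card (labelled_trees n) = card ?T"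
      using bij_betw_same_card[OF bij_betw_parcs_labelled_trees[of n "\<lambda>_. True"]] by simp
    have fin: "finite ?T" by (simp add: finite_trees_on)
    have "card ?T = n ^ (n - 2)" using elim by (simp add: card_trees_on)
    then have pos: "real (card ?T) > 0" using elim by simp
    have "card ?T = card (?many \<union> ?bad)" by (rule arg_cong[where f = card]) auto
    also have "\<dots> = card ?many + card ?bad" using fin by (intro card_Un_disjoint) auto
    finally have split: "card ?T = card ?many + card ?bad" .
    \<comment> \<open>Trees with many pendant paths have a large acquisition number, so their share
      bounds the share of good trees from below.\<close>
    have "card ?many = card {T \<in> labelled_trees n. \<not> real (card (pendant_paths (parcs T))) < ?c * n}"
      by (rule bij_betw_same_card[OF bij_betw_parcs_labelled_trees, symmetric])
    also have "\<dots> \<le> card (?good n)"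
    proof (rule card_mono)
      show "finite (?good n)" by (simp add: finite_labelled_trees)
      show "{T \<in> labelled_trees n. \<not> real (card (pendant_paths (parcs T))) < ?c * n} \<subseteq> ?good n"
      proof safe
        fix T assume T: "T \<in> labelled_trees n" "\<not> real (card (pendant_paths (parcs T))) < ?c * n"
        then have "card (pendant_paths (parcs T)) \<le> total_acquisition_number T"
          using elim by (intro card_pendant_paths_le_total_acquisition_number)
            (auto simp: labelled_trees_def)
        then show "real n / (3 * exp 3) \<le> real (total_acquisition_number T)"
          using T(2) by simp
      qed
    qed
    finally have "real (card ?T) - real (card ?bad) \<le> card (?good n)" using split by simp
    then have "(real (card ?T) - real (card ?bad)) / card ?T \<le> ?ratio n"
      unfolding t by (rule divide_right_mono) simp
    then have "1 - real (card ?bad) / card ?T \<le> ?ratio n"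
      using pos by (simp add: diff_divide_distrib)
    moreover have "real (card ?bad) / card ?T \<le> ?err n"
      by (rule few_pendant_paths_ratio_le) (use elim c in auto)
    ultimately show ?case by linarith
  qed
  have upper: "\<forall>\<^sub>F n in sequentially. ?ratio n \<le> 1"
  proof (intro always_eventually allI)
    fix n
    have "card (?good n) \<le> card (labelled_trees n)"
      by (intro card_mono finite_labelled_trees) auto
    then show "?ratio n \<le> 1" by (simp add: divide_le_eq)
  qed
  have "(\<lambda>n. 1 - ?err n) \<longlonglongrightarrow> 1 - 0" using err by (intro tendsto_intros)
  then have "?ratio \<longlonglongrightarrow> 1"
    using tendsto_sandwich[OF lower upper] by simp
  then show ?thesis by (simp add: almost_all_trees_def)
qed

end
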